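(* Let $m\le n$ and let $\mathbf G=G_0+G_1\mathbf i+G_2\mathbf j+G_3\mathbf k\in\mathbb Q^{m\times n}$ be a quaternion random matrix, where $G_0,G_1,G_2,G_3$ are real $m\times n$ matrices all of whose entries are independent $N(0,1)$ random variables. Then $$\mathsf E\,\|\mathbf G^\dagger\|_F^2=\frac{m}{4(n-m)+2}.$$
   Context: $\mathbb Q$ denotes the real quaternions with imaginary units $\mathbf i,\mathbf j,\mathbf k$. $\mathbf G^\dagger$ is the Moore–Penrose pseudoinverse, and $\|\mathbf M\|_F=(\sum_{i,j}|\mathbf m_{ij}|^2)^{1/2}$ is the Frobenius norm, with $|\cdot|$ the quaternion modulus. *)

theory Defs
  imports "HOL-Probability.Probability"
begin

section \<open>Real quaternions\<close>

codatatype quat = Quat (qRe: real) (qIm1: real) (qIm2: real) (qIm3: real)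

lemma quat_eq_iff:
  "x = y \<longleftrightarrow> qRe x = qRe y \<and> qIm1 x = qIm1 y \<and> qIm2 x = qIm2 y \<and> qIm3 x = qIm3 y"
  by (auto intro: quat.expand)

instantiation quat :: ab_group_add
begin

primcorec zero_quat
  where
    "qRe 0 = 0"
  | "qIm1 0 = 0"
  | "qIm2 0 = 0"
  | "qIm3 0 = 0"

primcorec plus_quat
  where
    "qRe (x + y) = qRe x + qRe y"
  | "qIm1 (x + y) = qIm1 x + qIm1 y"
  | "qIm2 (x + y) = qIm2 x + qIm2 y"
  | "qIm3 (x + y) = qIm3 x + qIm3 y"

primcorec uminus_quat
  where
    "qRe (- x) = - qRe x"
  | "qIm1 (- x) = - qIm1 x"
  | "qIm2 (- x) = - qIm2 x"
  | "qIm3 (- x) = - qIm3 x"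

primcorec minus_quat
  where
    "qRe (x - y) = qRe x - qRe y"
  | "qIm1 (x - y) = qIm1 x - qIm1 y"
  | "qIm2 (x - y) = qIm2 x - qIm2 y"
  | "qIm3 (x - y) = qIm3 x - qIm3 y"

instance
  by standard (simp_all add: quat_eq_iff)

end

instantiation quat :: ring_1
begin

primcorec one_quat
  where
    "qRe 1 = 1"
  | "qIm1 1 = 0"
  | "qIm2 1 = 0"
  | "qIm3 1 = 0"

primcorec times_quat
  where
    "qRe (x * y) = qRe x * qRe y - qIm1 x * qIm1 y - qIm2 x * qIm2 y - qIm3 x * qIm3 y"
  | "qIm1 (x * y) = qRe x * qIm1 y + qIm1 x * qRe y + qIm2 x * qIm3 y - qIm3 x * qIm2 y"
  | "qIm2 (x * y) = qRe x * qIm2 y - qIm1 x * qIm3 y + qIm2 x * qRe y + qIm3 x * qIm1 y"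
  | "qIm3 (x * y) = qRe x * qIm3 y + qIm1 x * qIm2 y - qIm2 x * qIm1 y + qIm3 x * qRe y"

instance
  by standard (simp_all add: quat_eq_iff algebra_simps)

end

instantiation quat :: real_algebra_1
begin

primcorec scaleR_quat
  where
    "qRe (scaleR r x) = r * qRe x"
  | "qIm1 (scaleR r x) = r * qIm1 x"
  | "qIm2 (scaleR r x) = r * qIm2 x"
  | "qIm3 (scaleR r x) = r * qIm3 x"

instance
  by standard (simp_all add: quat_eq_iff algebra_simps)

end

instantiation quat :: real_div_algebra
begin

primcorec inverse_quat
  where
    "qRe (inverse x) = qRe x / ((qRe x)\<^sup>2 + (qIm1 x)\<^sup>2 + (qIm2 x)\<^sup>2 + (qIm3 x)\<^sup>2)"
  | "qIm1 (inverse x) = - qIm1 x / ((qRe x)\<^sup>2 + (qIm1 x)\<^sup>2 + (qIm2 x)\<^sup>2 + (qIm3 x)\<^sup>2)"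
  | "qIm2 (inverse x) = - qIm2 x / ((qRe x)\<^sup>2 + (qIm1 x)\<^sup>2 + (qIm2 x)\<^sup>2 + (qIm3 x)\<^sup>2)"
  | "qIm3 (inverse x) = - qIm3 x / ((qRe x)\<^sup>2 + (qIm1 x)\<^sup>2 + (qIm2 x)\<^sup>2 + (qIm3 x)\<^sup>2)"

definition "x div y = x * inverse y" for x y :: quat

instance
proof
  fix x y :: quat
  let ?n = "(qRe x)\<^sup>2 + (qIm1 x)\<^sup>2 + (qIm2 x)\<^sup>2 + (qIm3 x)\<^sup>2"
  have n: "?n \<noteq> 0" if "x \<noteq> 0"
    using that by (auto simp: quat_eq_iff add_nonneg_eq_0_iff)
  show "inverse x * x = 1" if "x \<noteq> 0"
    using n[OF that]
    by (simp add: quat_eq_iff add_divide_distrib[symmetric] diff_divide_distrib[symmetric]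
        power2_eq_square mult.commute)
  show "x * inverse x = 1" if "x \<noteq> 0"
    using n[OF that]
    by (simp add: quat_eq_iff add_divide_distrib[symmetric] diff_divide_distrib[symmetric]
        power2_eq_square mult.commute)
  show "x div y = x * inverse y"
    by (rule divide_quat_def)
  show "inverse (0::quat) = 0"
    by (simp add: quat_eq_iff)
qed

end

instantiation quat :: real_inner
begin

definition inner_quat_def:
  "inner x y = qRe x * qRe y + qIm1 x * qIm1 y + qIm2 x * qIm2 y + qIm3 x * qIm3 y"

definition norm_quat_def:
  "norm x = sqrt ((qRe x)\<^sup>2 + (qIm1 x)\<^sup>2 + (qIm2 x)\<^sup>2 + (qIm3 x)\<^sup>2)"

definition sgn_quat_def: "sgn (x::quat) = x /\<^sub>R norm x"

definition dist_quat_def: "dist x y = norm (x - y)" for x y :: quat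

definition uniformity_quat_def [code del]:
  "(uniformity :: (quat \<times> quat) filter) = (INF e\<in>{0 <..}. principal {(x, y). dist x y < e})"

definition open_quat_def [code del]:
  "open (U :: quat set) \<longleftrightarrow> (\<forall>x\<in>U. eventually (\<lambda>(x', y). x' = x \<longrightarrow> y \<in> U) uniformity)"

instance
proof
  fix x y z :: quat and r :: real
  show "inner x y = inner y x"
    by (simp add: inner_quat_def mult.commute)
  show "inner (x + y) z = inner x z + inner y z"
    by (simp add: inner_quat_def algebra_simps)
  show "inner (scaleR r x) y = r * inner x y"
    by (simp add: inner_quat_def algebra_simps)
  show "0 \<le> inner x x"
    by (simp add: inner_quat_def)
  show "inner x x = 0 \<longleftrightarrow> x = 0"
    by (simp add: inner_quat_def quat_eq_iff add_nonneg_eq_0_iff)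
  show "norm x = sqrt (inner x x)"
    by (simp add: inner_quat_def norm_quat_def power2_eq_square)
qed (rule sgn_quat_def dist_quat_def open_quat_def uniformity_quat_def)+

end

instance quat :: real_normed_div_algebra
  by standard
    (simp add: norm_quat_def real_sqrt_mult[symmetric] power2_eq_square algebra_simps)

primcorec qcnj :: "quat \<Rightarrow> quat"
  where
    "qRe (qcnj x) = qRe x"
  | "qIm1 (qcnj x) = - qIm1 x"
  | "qIm2 (qcnj x) = - qIm2 x"
  | "qIm3 (qcnj x) = - qIm3 x"

definition quat_i :: quat where "quat_i = Quat 0 1 0 0"
definition quat_j :: quat where "quat_j = Quat 0 0 1 0"
definition quat_k :: quat where "quat_k = Quat 0 0 0 1"

lemma quat_units:
  "quat_i * quat_i = -1" "quat_j * quat_j = -1" "quat_k * quat_k = -1"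
  "quat_i * quat_j = quat_k" "quat_j * quat_k = quat_i" "quat_k * quat_i = quat_j"
  by (simp_all add: quat_eq_iff quat_i_def quat_j_def quat_k_def)

lemma Quat_eq:
  "Quat a b c d = of_real a + of_real b * quat_i + of_real c * quat_j + of_real d * quat_k"
  by (simp add: quat_eq_iff of_real_def quat_i_def quat_j_def quat_k_def)

lemma qcnj_mult: "qcnj (x * y) = qcnj y * qcnj x"
  by (simp add: quat_eq_iff algebra_simps)

lemma qcnj_zero [simp]: "qcnj 0 = 0"
  by (simp add: quat_eq_iff)

lemma qcnj_add: "qcnj (x + y) = qcnj x + qcnj y"
  by (simp add: quat_eq_iff)

lemma qcnj_sum: "qcnj (sum f A) = (\<Sum>a\<in>A. qcnj (f a))"
  by (induction A rule: infinite_finite_induct) (simp_all add: qcnj_add)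


section \<open>Quaternion matrices\<close>

text \<open>As usual, \<open>quat^'n^'m\<close> has rows indexed by \<open>'m\<close> and columns indexed by \<open>'n\<close>.\<close>

definition conj_transpose :: "quat^'n^'m \<Rightarrow> quat^'m^'n"
  where "conj_transpose A = (\<chi> i j. qcnj (A $ j $ i))"

definition frobenius_norm :: "quat^'n^'m \<Rightarrow> real"
  where "frobenius_norm A = sqrt (\<Sum>i\<in>UNIV. \<Sum>j\<in>UNIV. (norm (A $ i $ j))\<^sup>2)"

definition is_pseudoinverse :: "quat^'n^'m \<Rightarrow> quat^'m^'n \<Rightarrow> bool"
  where "is_pseudoinverse A X \<longleftrightarrow>
    A ** X ** A = A \<and> X ** A ** X = X \<and>
    conj_transpose (A ** X) = A ** X \<and> conj_transpose (X ** A) = X ** A"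

definition pseudoinverse :: "quat^'n^'m \<Rightarrow> quat^'m^'n"
  where "pseudoinverse A = (THE X. is_pseudoinverse A X)"

lemma conj_transpose_mult:
  "conj_transpose (A ** B) = conj_transpose B ** conj_transpose A"
  by (simp add: conj_transpose_def matrix_matrix_mult_def vec_eq_iff qcnj_sum qcnj_mult)

lemma is_pseudoinverse_unique:
  assumes "is_pseudoinverse A X" "is_pseudoinverse A Y"
  shows "X = Y"
proof -
  note X = assms(1)[unfolded is_pseudoinverse_def]
  note Y = assms(2)[unfolded is_pseudoinverse_def]
  have "A ** X = conj_transpose (A ** Y ** A ** X)"
    using X Y by simp
  also have "\<dots> = conj_transpose (A ** X) ** conj_transpose (A ** Y)"
    by (simp add: conj_transpose_mult[symmetric] matrix_mul_assoc)
  also have "\<dots> = A ** Y"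
    using X Y by (simp add: matrix_mul_assoc)
  finally have AX: "A ** X = A ** Y" .
  have "X ** A = conj_transpose (X ** (A ** Y ** A))"
    using X Y by simp
  also have "\<dots> = conj_transpose (Y ** A) ** conj_transpose (X ** A)"
    by (simp add: conj_transpose_mult[symmetric] matrix_mul_assoc)
  also have "\<dots> = Y ** (A ** X ** A)"
    using X Y by (simp add: matrix_mul_assoc[symmetric])
  also have "\<dots> = Y ** A"
    using X by simp
  finally have XA: "X ** A = Y ** A" .
  have "X = Y ** A ** X"
    using X XA by metis
  also have "\<dots> = Y ** A ** Y"
    using AX by (simp add: matrix_mul_assoc[symmetric])
  finally show ?thesis
    using Y by simp
qed

lemma pseudoinverse_eqI: "is_pseudoinverse A X \<Longrightarrow> pseudoinverse A = X"
  unfolding pseudoinverse_def by (blast intro: the_equality is_pseudoinverse_unique)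

end

theory Submission
  imports Defs "HOL-Real_Asymp.Real_Asymp"
begin

text \<open>If no row \<open>g\<^sub>i\<close> of \<open>G\<close> lies in the left span \<open>V\<^sub>i\<close> of the other rows, then the \<open>i\<close>-th column
  of the pseudoinverse is the conjugate of \<open>z\<^sub>i / |z\<^sub>i|\<^sup>2\<close>, where \<open>z\<^sub>i\<close> is the component of \<open>g\<^sub>i\<close>
  orthogonal to \<open>V\<^sub>i\<close>; so the squared Frobenius norm is the sum of the \<open>1 / dist(g\<^sub>i, V\<^sub>i)\<^sup>2\<close>.
  Conditionally on the other rows, \<open>dist(g\<^sub>i, V\<^sub>i)\<^sup>2\<close> is a chi-square variable with
  \<open>k = 4 n - dim V\<^sub>i\<close> degrees of freedom. Its inverse moment is \<open>1 / (k - 2)\<close>, as one sees by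
  integrating its Laplace transform \<open>(1 + 2 t) powr (- k / 2)\<close> over \<open>t \<ge> 0\<close>. Since always
  \<open>dim V\<^sub>i \<le> 4 (m - 1)\<close>, this moment is finite, which already forces \<open>g\<^sub>i \<notin> V\<^sub>i\<close> almost surely,
  hence \<open>dim V\<^sub>i = 4 (m - 1)\<close> and \<open>k - 2 = 4 (n - m) + 2\<close> almost surely.\<close>

section \<open>Gaussian quadratic forms\<close>

abbreviation (input) std_gaussian :: "'i set \<Rightarrow> ('i \<Rightarrow> real) measure" where
  "std_gaussian J \<equiv> PiM J (\<lambda>_. std_normal_distribution)"

interpretation std_normal: prob_space std_normal_distribution
  by (rule prob_space_normal_density) simp

lemma product_sigma_finite_std_normal: "product_sigma_finite (\<lambda>_. std_normal_distribution)"
  by standard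

lemma prob_space_std_gaussian: "prob_space (std_gaussian J)"
  by (rule prob_space_PiM) (rule std_normal.prob_space_axioms)

text \<open>The factor \<open>exp (- (t * z\<^sup>2))\<close> turns the standard density into
  \<open>\<sigma>\<close> times a centred normal density of variance \<open>1 / (1 + 2 * t)\<close>,
  whose total mass is 1.\<close>

lemma integral_exp_square_std_normal:
  assumes "0 \<le> (t::real)"
  shows "(LINT z|std_normal_distribution. exp (- (t * z\<^sup>2))) = 1 / sqrt (1 + 2 * t)"
proof -
  define \<sigma> where "\<sigma> = 1 / sqrt (1 + 2 * t)"
  have \<sigma>: "\<sigma> > 0" "\<sigma>\<^sup>2 = 1 / (1 + 2 * t)"
    using assms by (auto simp: \<sigma>_def power_divide)
  have "std_normal_density z *\<^sub>R exp (- (t * z\<^sup>2)) = \<sigma> * normal_density 0 \<sigma> z" for z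
  proof -
    have "exp (- z\<^sup>2 / 2) * exp (- (t * z\<^sup>2)) = exp (- (z - 0)\<^sup>2 / (2 * \<sigma>\<^sup>2))"
      using assms by (simp add: \<sigma> exp_add[symmetric] field_simps)
    moreover have "\<sigma> / sqrt (2 * pi * \<sigma>\<^sup>2) = 1 / sqrt (2 * pi)"
      using \<sigma>(1) by (simp add: real_sqrt_mult)
    ultimately show ?thesis
      by (simp add: normal_density_def real_sqrt_mult) (simp add: field_simps)
  qed
  then have "(LINT z|std_normal_distribution. exp (- (t * z\<^sup>2)))
      = (LINT z|lborel. \<sigma> * normal_density 0 \<sigma> z)"
    by (subst integral_density) auto
  then show ?thesis
    using \<sigma>(1) by (simp add: \<sigma>_def)
qed

lemma integral_cis_std_gaussian:
  assumes "finite J"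
  shows "(LINT y|std_gaussian J. cis (\<Sum>j\<in>J. c j * y j)) = of_real (exp (- (\<Sum>j\<in>J. (c j)\<^sup>2) / 2))"
proof -
  have "(LINT y|std_gaussian J. cis (\<Sum>j\<in>J. c j * y j))
      = (LINT y|std_gaussian J. (\<Prod>j\<in>J. iexp (c j * y j)))"
    using assms by (simp add: cis_conv_exp sum_distrib_left exp_sum)
  also have "\<dots> = (\<Prod>j\<in>J. LINT x|std_normal_distribution. iexp (c j * x))"
    using assms
    by (intro product_sigma_finite.product_integral_prod[OF product_sigma_finite_std_normal] std_normal.integrable_const_bound[where B=1]) auto
  also have "\<dots> = (\<Prod>j\<in>J. complex_of_real (exp (- ((c j)\<^sup>2) / 2)))"
    using char_std_normal_distribution[unfolded char_def, THEN fun_cong] by simp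
  also have "\<dots> = of_real (exp (\<Sum>j\<in>J. - ((c j)\<^sup>2) / 2))"
    using assms by (simp add: exp_sum del: of_real_exp)
  finally show ?thesis
    by (simp add: sum_negf sum_divide_distrib del: of_real_exp)
qed

text \<open>The characteristic function of an auxiliary Gaussian vector \<open>z\<close> linearises the quadratic
  form; integrating in the other order only uses that \<open>a\<close> is an isometry, so no change of
  variables in the Gaussian measure is needed.\<close>

lemma integral_exp_quadratic_form_std_gaussian:
  fixes a :: "'k \<Rightarrow> 'j \<Rightarrow> real" and J :: "'j set" and K :: "'k set"
  assumes fin: "finite J" "finite K" and t: "0 \<le> t"
    and isometry: "\<And>z. (\<Sum>j\<in>J. (\<Sum>k\<in>K. z k * a k j)\<^sup>2) = (\<Sum>k\<in>K. (z k)\<^sup>2)"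
  shows "(LINT y|std_gaussian J. exp (- (t * (\<Sum>k\<in>K. (\<Sum>j\<in>J. a k j * y j)\<^sup>2))))
    = (1 / sqrt (1 + 2 * t)) ^ card K"
proof -
  \<comment> \<open>With this scaling a Gaussian characteristic function at frequency
    \<open>s * c\<close> equals \<open>exp (- (t * c\<^sup>2))\<close>.\<close>
  define s where "s = sqrt (2 * t)"
  have s2: "s\<^sup>2 = 2 * t"
    using t by (simp add: s_def)
  interpret J: prob_space "std_gaussian J" by (rule prob_space_std_gaussian)
  interpret K: prob_space "std_gaussian K" by (rule prob_space_std_gaussian)
  interpret KJ: pair_prob_space "std_gaussian K" "std_gaussian J" ..
  define F where "F z y = cis (\<Sum>k\<in>K. \<Sum>j\<in>J. s * z k * a k j * y j)" for z y
  have F_int: "integrable (std_gaussian K \<Otimes>\<^sub>M std_gaussian J) (\<lambda>(z, y). F z y)"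
    by (rule KJ.integrable_const_bound[where B=1]) (auto simp: F_def cis_conv_exp split_beta')
  have y_int: "(LINT y|std_gaussian J. F z y) = of_real (exp (- (t * (\<Sum>k\<in>K. (z k)\<^sup>2))))" for z
  proof -
    have "F z y = cis (\<Sum>j\<in>J. (s * (\<Sum>k\<in>K. z k * a k j)) * y j)" for y
      unfolding F_def by (subst sum.swap) (simp add: sum_distrib_left sum_distrib_right mult_ac)
    moreover have "(\<Sum>j\<in>J. (s * (\<Sum>k\<in>K. z k * a k j))\<^sup>2) / 2 = t * (\<Sum>k\<in>K. (z k)\<^sup>2)"
      by (simp add: power_mult_distrib sum_distrib_left[symmetric] isometry s2)
    ultimately show ?thesis
      by (simp add: integral_cis_std_gaussian[OF fin(1)] del: of_real_exp)
  qed
  have z_int: "(LINT z|std_gaussian K. F z y)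
      = of_real (exp (- (t * (\<Sum>k\<in>K. (\<Sum>j\<in>J. a k j * y j)\<^sup>2))))" for y
  proof -
    have "F z y = cis (\<Sum>k\<in>K. (s * (\<Sum>j\<in>J. a k j * y j)) * z k)" for z
      unfolding F_def by (simp add: sum_distrib_left sum_distrib_right mult_ac)
    moreover have "(\<Sum>k\<in>K. (s * (\<Sum>j\<in>J. a k j * y j))\<^sup>2) / 2
        = t * (\<Sum>k\<in>K. (\<Sum>j\<in>J. a k j * y j)\<^sup>2)"
      by (simp add: power_mult_distrib sum_distrib_left[symmetric] s2)
    ultimately show ?thesis
      by (simp add: integral_cis_std_gaussian[OF fin(2)] del: of_real_exp)
  qed
  have "complex_of_real (LINT y|std_gaussian J. exp (- (t * (\<Sum>k\<in>K. (\<Sum>j\<in>J. a k j * y j)\<^sup>2))))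
      = complex_of_real (LINT z|std_gaussian K. exp (- (t * (\<Sum>k\<in>K. (z k)\<^sup>2))))"
    using KJ.Fubini_integral[OF F_int] y_int z_int
    by (simp add: integral_complex_of_real[symmetric] del: of_real_exp integral_complex_of_real)
  also have "(LINT z|std_gaussian K. exp (- (t * (\<Sum>k\<in>K. (z k)\<^sup>2))))
      = (LINT z|std_gaussian K. (\<Prod>k\<in>K. exp (- (t * (z k)\<^sup>2))))"
    using fin by (simp add: exp_sum[symmetric] sum_distrib_left sum_negf)
  also have "\<dots> = (\<Prod>k\<in>K. LINT x|std_normal_distribution. exp (- (t * x\<^sup>2)))"
    using fin t
    by (intro product_sigma_finite.product_integral_prod[OF product_sigma_finite_std_normal] std_normal.integrable_const_bound[where B=1]) auto
  finally show ?thesis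
    by (simp only: of_real_eq_iff) (simp add: integral_exp_square_std_normal[OF t])
qed

text \<open>Stated in \<open>ennreal\<close> so that \<open>r = 0\<close> is included: there both
  sides are infinite. Distance 0 is thus not a special case in the moment computations, and
  finiteness of the moment can later exclude it.\<close>

lemma nn_integral_exp_Ioi:
  assumes "0 \<le> r"
  shows "(\<integral>\<^sup>+t. ennreal (exp (- (t * r))) * indicator {0..} t \<partial>lborel) = inverse (ennreal r)"
proof (cases "r = 0")
  case True
  have "of_nat n \<le> emeasure lborel {0::real..}" for n
    using emeasure_mono[of "{0..real n}" "{0..}" lborel] by (simp add: ennreal_of_nat_eq_real_of_nat)
  then have "emeasure lborel {0::real..} = \<top>"
    by (metis ennreal_Ex_less_of_nat infinity_ennreal_def leD less_top)
  with True show ?thesis by simp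
next
  case False
  with assms have r: "0 < r" by simp
  have "((\<lambda>t. - exp (- (t * r)) / r) \<longlongrightarrow> 0) at_top"
    using r by real_asymp
  then have "(\<integral>\<^sup>+t. ennreal (exp (- (t * r))) * indicator {0..} t \<partial>lborel)
      = ennreal (0 - (- exp (- (0 * r)) / r))"
    using r
    by (intro nn_integral_FTC_atLeast) (auto intro!: derivative_eq_intros simp: field_simps)
  also have "\<dots> = inverse (ennreal r)"
    using r by (simp add: inverse_ennreal divide_inverse)
  finally show ?thesis .
qed

text \<open>The antiderivative \<open>?F\<close> is a multiple of
  \<open>(1 + 2 * t) powr (1 - real k / 2)\<close>. For \<open>3 \<le> k\<close> the exponent is
  negative, so \<open>?F\<close> vanishes at infinity and only its value at 0 remains.\<close>

lemma nn_integral_inverse_sqrt_power: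
  assumes "3 \<le> k"
  shows "(\<integral>\<^sup>+t. ennreal ((1 / sqrt (1 + 2 * t)) ^ k) * indicator {0..} t \<partial>lborel)
    = ennreal (1 / (real k - 2))"
proof -
  let ?F = "\<lambda>t::real. - ((1 + 2 * t) powr (1 - real k / 2)) / (real k - 2)"
  have k: "real k > 2" using assms by linarith
  have pw: "(1 / sqrt (1 + 2 * t)) ^ k = (1 + 2 * t) powr (- (real k / 2))" if "0 \<le> t" for t
  proof -
    have "sqrt (1 + 2 * t) ^ k = ((1 + 2 * t) powr (1 / 2)) powr real k"
      using that by (simp add: powr_half_sqrt powr_realpow)
    also have "\<dots> = (1 + 2 * t) powr (real k / 2)"
      by (simp add: powr_powr)
    finally show ?thesis
      by (simp add: powr_minus power_one_over inverse_eq_divide)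
  qed
  have "(?F \<longlongrightarrow> 0) at_top"
    using k by real_asymp
  moreover have "(?F has_real_derivative (1 + 2 * t) powr (- (real k / 2))) (at t)" if "0 \<le> t" for t
  proof -
    define c where "c = 1 - real k / 2"
    have c: "- (c * 2) / (real k - 2) = 1" "c - 1 = - (real k / 2)"
      using k by (simp_all add: c_def)
    have "((\<lambda>t. (1 + 2 * t) powr c) has_real_derivative (c * 2) * (1 + 2 * t) powr (c - 1)) (at t)"
      using that by (auto intro!: derivative_eq_intros)
    moreover have "- (c * 2 * p) / (real k - 2) = p" for p
      using c(1) by (metis minus_mult_left mult_1 times_divide_eq_left)
    ultimately show ?thesis
      using DERIV_cdivide[OF DERIV_minus, of "\<lambda>t. (1 + 2 * t) powr c" _ t UNIV "real k - 2"]
      by (metis c(2) c_def)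
  qed
  ultimately have "(\<integral>\<^sup>+t. ennreal ((1 + 2 * t) powr (- (real k / 2))) * indicator {0..} t \<partial>lborel)
    = ennreal (0 - ?F 0)"
    by (intro nn_integral_FTC_atLeast) auto
  moreover have "(\<integral>\<^sup>+t. ennreal ((1 / sqrt (1 + 2 * t)) ^ k) * indicator {0..} t \<partial>lborel)
     = (\<integral>\<^sup>+t. ennreal ((1 + 2 * t) powr (- (real k / 2))) * indicator {0..} t \<partial>lborel)"
    by (intro nn_integral_cong) (auto simp: pw indicator_def)
  ultimately show ?thesis by simp
qed

text \<open>The isometry condition says that the rows of \<open>a\<close> are orthonormal, so the
  form is chi-square with \<open>card K\<close> degrees of freedom. Its inverse is written as an
  integral of exponentials, and Tonelli reduces the claim to the Laplace transform.\<close>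

lemma nn_integral_inverse_quadratic_form_std_gaussian:
  fixes a :: "'k \<Rightarrow> 'j \<Rightarrow> real" and J :: "'j set" and K :: "'k set"
  assumes fin: "finite J" "finite K" and K: "3 \<le> card K"
    and isometry: "\<And>z. (\<Sum>j\<in>J. (\<Sum>k\<in>K. z k * a k j)\<^sup>2) = (\<Sum>k\<in>K. (z k)\<^sup>2)"
  shows "(\<integral>\<^sup>+y. inverse (ennreal (\<Sum>k\<in>K. (\<Sum>j\<in>J. a k j * y j)\<^sup>2)) \<partial>std_gaussian J)
    = ennreal (1 / (real (card K) - 2))"
proof -
  interpret J: prob_space "std_gaussian J" by (rule prob_space_std_gaussian)
  interpret P: pair_sigma_finite "std_gaussian J" lborel ..
  define Q where "Q y = (\<Sum>k\<in>K. (\<Sum>j\<in>J. a k j * y j)\<^sup>2)" for y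
  have Q: "0 \<le> Q y" for y
    unfolding Q_def by (intro sum_nonneg) auto
  have [measurable]: "Q \<in> borel_measurable (std_gaussian J)"
    unfolding Q_def by measurable
  have "(\<integral>\<^sup>+y. inverse (ennreal (Q y)) \<partial>std_gaussian J)
      = (\<integral>\<^sup>+y. \<integral>\<^sup>+t. ennreal (exp (- (t * Q y))) * indicator {0..} t \<partial>lborel \<partial>std_gaussian J)"
    using Q by (simp add: nn_integral_exp_Ioi)
  also have "\<dots> = (\<integral>\<^sup>+t. \<integral>\<^sup>+y. ennreal (exp (- (t * Q y))) * indicator {0..} t \<partial>std_gaussian J \<partial>lborel)"
    by (rule P.Fubini'[symmetric]) measurable
  also have "\<dots> = (\<integral>\<^sup>+t. ennreal ((1 / sqrt (1 + 2 * t)) ^ card K) * indicator {0..} t \<partial>lborel)"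
  proof (intro nn_integral_cong)
    fix t :: real
    show "(\<integral>\<^sup>+y. ennreal (exp (- (t * Q y))) * indicator {0..} t \<partial>std_gaussian J)
      = ennreal ((1 / sqrt (1 + 2 * t)) ^ card K) * indicator {0..} t"
    proof (cases "0 \<le> t")
      case True
      have "(\<integral>\<^sup>+y. ennreal (exp (- (t * Q y))) \<partial>std_gaussian J)
        = ennreal (LINT y|std_gaussian J. exp (- (t * Q y)))"
        using True Q by (intro nn_integral_eq_integral J.integrable_const_bound[where B=1]) auto
      then show ?thesis
        using integral_exp_quadratic_form_std_gaussian[OF fin True isometry] True
        by (simp add: Q_def)
    qed simp
  qed
  also have "\<dots> = ennreal (1 / (real (card K) - 2))"
    using K by (rule nn_integral_inverse_sqrt_power)
  finally show ?thesis
    by (simp add: Q_def)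
qed

section \<open>Distance of a Gaussian vector to a fixed subspace\<close>

lemma infdist_subspace:
  fixes V :: "'a::euclidean_space set"
  assumes "subspace V" "v \<in> V" "\<And>w. w \<in> V \<Longrightarrow> orthogonal w z"
  shows "infdist (v + z) V = norm z"
proof (rule antisym)
  show "infdist (v + z) V \<le> norm z"
    using infdist_le[OF assms(2), of "v + z"] by (simp add: dist_norm)
  \<comment> \<open>Pythagoras: \<open>v - w\<close> lies in \<open>V\<close>, hence is orthogonal
    to \<open>z\<close>.\<close>
  have "norm z \<le> dist (v + z) w" if "w \<in> V" for w
  proof -
    have "orthogonal (v - w) z"
      using assms(1,2) that by (intro assms(3) subspace_diff)
    then have "(dist (v + z) w)\<^sup>2 = (norm (v - w))\<^sup>2 + (norm z)\<^sup>2"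
      using norm_add_Pythagorean[of "v - w" z] unfolding dist_norm diff_add_eq by blast
    then show ?thesis
      by (intro power2_le_imp_le[OF _ zero_le_dist]) simp
  qed
  then show "norm z \<le> infdist (v + z) V"
    using assms(2) by (auto simp: infdist_def intro: cINF_greatest)
qed

text \<open>The squared distance to \<open>V\<close> is the sum of squared coordinates along an
  orthonormal basis \<open>E\<close> of the orthogonal complement. This is a quadratic form as above
  with coefficients \<open>e \<bullet> b j\<close> and \<open>DIM('a) - dim V\<close> degrees of
  freedom.\<close>

lemma nn_integral_inverse_infdist_subspace_std_gaussian:
  fixes V :: "'a::euclidean_space set" and b :: "'j \<Rightarrow> 'a"
  assumes V: "subspace V" and b: "bij_betw b J Basis" and dimV: "dim V + 3 \<le> DIM('a)"
  shows "(\<integral>\<^sup>+y. inverse (ennreal ((infdist (\<Sum>j\<in>J. y j *\<^sub>R b j) V)\<^sup>2)) \<partial>std_gaussian J)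
    = ennreal (1 / (real DIM('a) - real (dim V) - 2))"
proof -
  define W where "W = {y \<in> UNIV. \<forall>x \<in> V. orthogonal x y}"
  have dimW: "dim W + dim V = DIM('a)"
    unfolding W_def using dim_subspace_orthogonal_to_vectors[OF V, of UNIV] by simp
  have "subspace W"
    unfolding W_def using subspace_orthogonal_to_vectors[of V] by simp
  then obtain E where E: "E \<subseteq> W" "pairwise orthogonal E" "\<And>x. x \<in> E \<Longrightarrow> norm x = 1"
      "independent E" "card E = dim W" "span E = W"
    by (rule orthonormal_basis_subspace) blast
  have finE: "finite E"
    using E(4) by (rule independent_imp_finite)
  have finJ: "finite J"
    using b bij_betw_finite finite_Basis by blast
  have norm_E: "(norm (\<Sum>e\<in>E. c e *\<^sub>R e))\<^sup>2 = (\<Sum>e\<in>E. (c e)\<^sup>2)" for c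
  proof -
    have "pairwise (\<lambda>i j. orthogonal (c i *\<^sub>R i) (c j *\<^sub>R j)) E"
      using E(2) by (auto simp: pairwise_def orthogonal_clauses)
    from norm_sum_Pythagorean[OF finE this] show ?thesis
      using E(3) by (simp add: power_mult_distrib)
  qed
  have inner_E: "e \<bullet> (\<Sum>e\<in>E. c e *\<^sub>R e) = c e" if "e \<in> E" for c e
  proof -
    have "e \<bullet> (\<Sum>e\<in>E. c e *\<^sub>R e) = (\<Sum>e'\<in>E. if e' = e then c e else 0)"
      unfolding inner_sum_right using E(2,3) that
      by (intro sum.cong) (auto simp: pairwise_def orthogonal_def norm_eq_1)
    then show ?thesis
      using that finE by simp
  qed
  have infdist_V: "(infdist g V)\<^sup>2 = (\<Sum>e\<in>E. (e \<bullet> g)\<^sup>2)" for g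
  proof -
    obtain v z where vz: "v \<in> span V" "\<And>w. w \<in> span V \<Longrightarrow> orthogonal z w" "g = v + z"
      by (rule orthogonal_subspace_decomp_exists[of V g]) blast
    have "z \<in> span E"
      unfolding E(6) W_def using vz(2)[OF span_base] by (simp add: orthogonal_commute)
    then obtain c where c: "z = (\<Sum>e\<in>E. c e *\<^sub>R e)"
      unfolding span_finite[OF finE] by blast
    have "e \<bullet> g = c e" if "e \<in> E" for e
    proof -
      have "orthogonal v e"
        using vz(1) that E(1) V by (auto simp: W_def span_eq_iff[THEN iffD2])
      then show ?thesis
        using inner_E[OF that, of c] by (simp add: vz(3) inner_add_right orthogonal_def inner_commute flip: c)
    qed
    moreover have "infdist g V = norm z"
      unfolding vz(3) using vz(1) vz(2)[OF span_base] V
      by (intro infdist_subspace) (auto simp: orthogonal_commute span_eq_iff[THEN iffD2])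
    ultimately show ?thesis
      by (simp add: c norm_E)
  qed
  \<comment> \<open>Parseval: both sides are the squared norm of
    \<open>\<Sum>e\<in>E. z e *\<^sub>R e\<close>, once in the standard basis and once in
    \<open>E\<close>.\<close>
  have "(\<Sum>j\<in>J. (\<Sum>e\<in>E. z e * (e \<bullet> b j))\<^sup>2) = (\<Sum>e\<in>E. (z e)\<^sup>2)" for z
  proof -
    have "(\<Sum>j\<in>J. (\<Sum>e\<in>E. z e * (e \<bullet> b j))\<^sup>2) = (\<Sum>j\<in>J. ((\<Sum>e\<in>E. z e *\<^sub>R e) \<bullet> b j)\<^sup>2)"
      by (simp add: inner_sum_left)
    also have "\<dots> = (\<Sum>u\<in>Basis. ((\<Sum>e\<in>E. z e *\<^sub>R e) \<bullet> u)\<^sup>2)"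
      using b by (rule sum.reindex_bij_betw)
    also have "\<dots> = (norm (\<Sum>e\<in>E. z e *\<^sub>R e))\<^sup>2"
      unfolding power2_norm_eq_inner
      using euclidean_inner[of "\<Sum>e\<in>E. z e *\<^sub>R e", symmetric] unfolding power2_eq_square .
    finally show ?thesis
      by (simp add: norm_E)
  qed
  note * = nn_integral_inverse_quadratic_form_std_gaussian[OF finJ finE _ this]
  have "real (card E) = real DIM('a) - real (dim V)" "3 \<le> card E"
    using dimW dimV E(5) by linarith+
  moreover have "e \<bullet> (\<Sum>j\<in>J. y j *\<^sub>R b j) = (\<Sum>j\<in>J. (e \<bullet> b j) * y j)" for e y
    unfolding inner_sum_right inner_scaleR_right by (simp only: mult.commute)
  ultimately show ?thesis
    using * by (simp only: infdist_V)
qed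

section \<open>Quaternionic linear algebra\<close>

text \<open>This makes \<open>quat^'n\<close> a real Euclidean space, so that \<open>dim\<close> and
  \<open>orthogonal\<close> are real notions throughout; hence the factors 4 in dimensions.\<close>

instantiation quat :: euclidean_space
begin

definition Basis_quat_def: "Basis = {1, quat_i, quat_j, quat_k}"

instance
proof
  show "(Basis::quat set) \<noteq> {}" "finite (Basis::quat set)" by (simp_all add: Basis_quat_def)
  show "inner u v = (if u = v then 1 else 0)" if "u \<in> Basis" "v \<in> Basis" for u v :: quat
    using that unfolding Basis_quat_def insert_iff empty_iff
    by (elim disjE) (simp_all add: quat_i_def quat_j_def quat_k_def inner_quat_def quat_eq_iff)
  show "(\<forall>u\<in>Basis. inner x u = 0) \<longleftrightarrow> x = 0" for x :: quat
  proof -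
    have "(\<forall>u\<in>Basis. inner x u = 0) \<longleftrightarrow>
        inner x 1 = 0 \<and> inner x quat_i = 0 \<and> inner x quat_j = 0 \<and> inner x quat_k = 0"
      unfolding Basis_quat_def by blast
    then show ?thesis
      by (simp add: quat_i_def quat_j_def quat_k_def inner_quat_def quat_eq_iff)
  qed
qed

end

lemma DIM_quat [simp]: "DIM(quat) = 4"
  by (simp add: Basis_quat_def quat_i_def quat_j_def quat_k_def quat_eq_iff)

lemma qcnj_qcnj [simp]: "qcnj (qcnj q) = q"
  by (simp add: quat_eq_iff)

lemma qcnj_one [simp]: "qcnj 1 = 1"
  by (simp add: quat_eq_iff)

lemma qcnj_scaleR: "qcnj (r *\<^sub>R q) = r *\<^sub>R qcnj q"
  by (simp add: quat_eq_iff)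

lemma norm_qcnj [simp]: "norm (qcnj q) = norm q"
  by (simp add: norm_quat_def)

lemma qRe_sum: "qRe (sum f A) = (\<Sum>a\<in>A. qRe (f a))"
  by (induction A rule: infinite_finite_induct) simp_all

lemma linear_qcnj: "linear qcnj"
  by (rule linearI) (simp_all add: qcnj_add qcnj_scaleR)

lemma continuous_on_qcnj [continuous_intros]:
  "continuous_on S f \<Longrightarrow> continuous_on S (\<lambda>x. qcnj (f x))"
  using linear_qcnj bounded_linear.continuous_on[of qcnj S f]
  by (simp add: linear_conv_bounded_linear)

text \<open>The entries of \<open>A ** conj_transpose B\<close> are the values of this form on the
  rows of \<open>A\<close> and \<open>B\<close>.\<close>

definition herm :: "quat^'n \<Rightarrow> quat^'n \<Rightarrow> quat"
  where "herm u v = (\<Sum>k\<in>UNIV. u $ k * qcnj (v $ k))"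

lemma qRe_herm: "qRe (herm u v) = u \<bullet> v"
  by (simp add: herm_def qRe_sum inner_vec_def inner_quat_def)

lemma herm_scale_left: "herm (q *s u) v = q * herm u v"
  by (simp add: herm_def sum_distrib_left mult.assoc)

lemma herm_add_left: "herm (u + v) w = herm u w + herm v w"
  by (simp add: herm_def sum.distrib distrib_right)

lemma herm_scaleR_right: "herm u (r *\<^sub>R v) = r *\<^sub>R herm u v"
  by (simp add: herm_def qcnj_scaleR scaleR_sum_right)

lemma herm_self: "herm u u = of_real ((norm u)\<^sup>2)"
proof -
  have "q * qcnj q = of_real ((norm q)\<^sup>2)" for q
    by (simp add: quat_eq_iff norm_quat_def of_real_def power2_eq_square)
  then show ?thesis
    by (simp add: herm_def norm_vec_def L2_set_def sum_nonneg)
qed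

text \<open>Real orthogonality to a quaternionic line is quaternionic orthogonality: the imaginary
  components of \<open>herm u v\<close> are real parts of \<open>herm (q *s u) v\<close> for the units \<open>q\<close>.\<close>

lemma herm_eq_0I:
  assumes "\<And>q. orthogonal (q *s u) v"
  shows "herm u v = 0"
proof -
  have "qRe (q * herm u v) = 0" for q
    using assms by (simp add: qRe_herm herm_scale_left[symmetric] orthogonal_def)
  from this[of 1] this[of quat_i] this[of quat_j] this[of quat_k] show ?thesis
    by (simp add: quat_eq_iff quat_i_def quat_j_def quat_k_def)
qed

lemma frobenius_norm_eq_norm: "frobenius_norm A = norm A"
  by (simp add: frobenius_norm_def norm_vec_def L2_set_def sum_nonneg)

lemma conj_transpose_conj_transpose [simp]: "conj_transpose (conj_transpose A) = A"
  by (simp add: conj_transpose_def vec_eq_iff)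

lemma conj_transpose_mat_1 [simp]: "conj_transpose (mat 1) = mat 1"
  by (simp add: conj_transpose_def vec_eq_iff mat_def)

lemma norm_conj_transpose: "(norm (conj_transpose A))\<^sup>2 = (\<Sum>i\<in>UNIV. (norm (A $ i))\<^sup>2)"
  by (simp add: norm_vec_def L2_set_def sum_nonneg conj_transpose_def) (rule sum.swap)

text \<open>For a right inverse \<open>X\<close> all Penrose conditions are immediate except that
  \<open>X ** A\<close> is Hermitian. Here \<open>X ** A\<close> is
  \<open>conj_transpose A ** conj_transpose C ** A\<close>, so it suffices that \<open>C\<close> is
  Hermitian.\<close>

lemma is_pseudoinverse_right_inverse:
  fixes A :: "quat^'n^'m" and C :: "quat^'m^'m"
  assumes "A ** conj_transpose (C ** A) = mat 1"
  shows "is_pseudoinverse A (conj_transpose (C ** A))"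
proof -
  define X where "X = conj_transpose (C ** A)"
  have AX: "A ** X = mat 1"
    using assms by (simp add: X_def)
  have X: "X = conj_transpose A ** conj_transpose C"
    by (simp add: X_def conj_transpose_mult)
  have "C ** A ** conj_transpose A = conj_transpose (A ** X)"
    by (simp add: X conj_transpose_mult matrix_mul_assoc)
  then have "C ** A ** conj_transpose A = mat 1"
    by (simp add: AX)
  \<comment> \<open>\<open>C\<close> is a left inverse and \<open>conj_transpose C\<close> a right
    inverse of \<open>A ** conj_transpose A\<close>, so the two coincide.\<close>
  then have "conj_transpose C = C ** (A ** (conj_transpose A ** conj_transpose C))"
    by (metis matrix_mul_assoc matrix_mul_lid)
  then have C: "conj_transpose C = C"
    using AX by (simp add: X)
  have "conj_transpose (X ** A) = X ** A"
    by (simp add: X conj_transpose_mult C matrix_mul_assoc)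
  then have "is_pseudoinverse A X"
    by (simp add: is_pseudoinverse_def AX matrix_mul_assoc[symmetric])
  then show ?thesis
    by (simp add: X_def)
qed

section \<open>Left row spans and their real dimension\<close>

definition row_comb :: "quat^'m \<Rightarrow> quat^'n^'m \<Rightarrow> quat^'n"
  where "row_comb c A = (\<chi> k. \<Sum>j\<in>UNIV. c $ j * A $ j $ k)"

text \<open>\<open>span\<close> would take real combinations only. As an image of the coefficient
  vectors supported on \<open>S\<close> under a real-linear map, the left quaternionic span has a
  real dimension comparable with that of the coefficient space.\<close>

definition row_span :: "'m set \<Rightarrow> quat^'n^'m \<Rightarrow> (quat^'n) set"
  where "row_span S A = (\<lambda>c. row_comb c A) ` {c. \<forall>j. j \<notin> S \<longrightarrow> c $ j = 0}"

lemma linear_row_comb: "linear (\<lambda>c. row_comb c A)"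
  by (rule linearI)
    (simp_all add: row_comb_def vec_eq_iff distrib_right sum.distrib scaleR_sum_right)

lemma row_comb_diff: "row_comb (c - d) A = row_comb c A - row_comb d A"
  using linear_row_comb by (rule linear_diff)

lemma row_comb_scale: "row_comb (q *s c) A = q *s row_comb c A"
  by (simp add: row_comb_def vec_eq_iff sum_distrib_left mult.assoc)

lemma row_comb_axis: "row_comb (axis i q) A = q *s A $ i"
  by (simp add: row_comb_def vec_eq_iff axis_def if_distrib[where f = "\<lambda>x. x * _"] cong: if_cong)

lemma matrix_mult_row_comb: "(C ** A) $ i = row_comb (C $ i) A"
  by (simp add: row_comb_def matrix_matrix_mult_def vec_eq_iff)

lemma continuous_on_row_comb [continuous_intros]: "continuous_on S (row_comb c)"
  unfolding row_comb_def by (intro continuous_intros)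

lemma subspace_row_span: "subspace (row_span S A)"
  unfolding row_span_def
  by (intro linear_subspace_image[OF linear_row_comb]) (auto simp: subspace_def)

lemma row_span_scale: "v \<in> row_span S A \<Longrightarrow> q *s v \<in> row_span S A"
proof -
  assume "v \<in> row_span S A"
  then obtain c where "\<forall>j. j \<notin> S \<longrightarrow> c $ j = 0" "v = row_comb c A"
    by (auto simp: row_span_def)
  then show ?thesis
    unfolding row_span_def by (intro image_eqI[where x = "q *s c"]) (auto simp: row_comb_scale)
qed

lemma row_in_row_span: "i \<in> S \<Longrightarrow> A $ i \<in> row_span S A"
  unfolding row_span_def
  by (rule image_eqI[where x = "axis i 1"]) (simp add: row_comb_axis, auto simp: axis_def)

lemma dim_supported_quat_vec:
  fixes S :: "'m::finite set"
  shows "dim {c :: quat^'m. \<forall>j. j \<notin> S \<longrightarrow> c $ j = 0} = 4 * card S"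
proof -
  define d :: "(quat^'m) set" where "d = (\<lambda>(j, b). axis j b) ` (S \<times> Basis)"
  have "d \<subseteq> Basis"
    by (auto simp: d_def Basis_vec_def)
  then have "dim {c. \<forall>i\<in>Basis. i \<notin> d \<longrightarrow> c \<bullet> i = 0} = card d"
    by (rule dim_substandard)
  moreover have "card d = 4 * card S"
  proof -
    have "inj_on (\<lambda>(j, b). axis j b :: quat^'m) (S \<times> Basis)"
      by (auto simp: inj_on_def axis_eq_axis)
    then show ?thesis
      by (simp add: d_def card_image card_cartesian_product)
  qed
  moreover have "(\<forall>i\<in>Basis. i \<notin> d \<longrightarrow> c \<bullet> i = 0) \<longleftrightarrow> (\<forall>j. j \<notin> S \<longrightarrow> c $ j = 0)" for c :: "quat^'m"
  proof -
    have "axis j b \<notin> d \<longleftrightarrow> j \<notin> S" if "b \<in> Basis" for j and b :: quat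
      using that by (auto simp: d_def axis_eq_axis)
    then show ?thesis
      by (auto simp: Basis_vec_def inner_axis euclidean_eq_iff[where 'a = quat])
  qed
  ultimately show ?thesis by simp
qed

lemma dim_row_span_le: "dim (row_span S A) \<le> 4 * card S"
  unfolding row_span_def
  using dim_image_le[OF linear_row_comb] unfolding dim_supported_quat_vec[symmetric] .

text \<open>In a division ring a nontrivial left relation between the rows can be solved for any row
  with nonzero coefficient. So the hypothesis makes \<open>row_comb\<close> injective in its
  coefficients, and dimension is preserved.\<close>

lemma dim_row_span:
  assumes "\<And>i. A $ i \<notin> row_span (- {i}) A"
  shows "dim (row_span S A) = 4 * card S"
proof -
  have "c = 0" if c: "row_comb c A = 0" for c
  proof (rule ccontr)
    assume "c \<noteq> 0"
    then obtain i where i: "c $ i \<noteq> 0"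
      by (auto simp: vec_eq_iff)
    define d where "d = axis i 1 - inverse (c $ i) *s c"
    have "row_comb d A = A $ i"
      by (simp add: d_def row_comb_diff row_comb_scale row_comb_axis c)
    moreover have "d $ i = 0"
      using i by (simp add: d_def axis_def)
    ultimately have "A $ i \<in> row_span (- {i}) A"
      unfolding row_span_def by (intro image_eqI[where x = d]) auto
    with assms show False by blast
  qed
  then have "inj (\<lambda>c. row_comb c A)"
    using linear_injective_0[OF linear_row_comb] by blast
  then show ?thesis
    unfolding row_span_def
    using dim_image_eq[OF linear_row_comb inj_on_subset[OF _ subset_UNIV]]
    unfolding dim_supported_quat_vec[symmetric] by blast
qed

section \<open>The pseudoinverse in terms of distances between rows\<close>

lemma norm_pseudoinverse_rows:
  fixes A :: "quat^'n^'m"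
  assumes indep: "\<And>i. A $ i \<notin> row_span (- {i}) A"
  shows "(frobenius_norm (pseudoinverse A))\<^sup>2
    = (\<Sum>i\<in>UNIV. 1 / (infdist (A $ i) (row_span (- {i}) A))\<^sup>2)"
proof -
  define V where "V i = row_span (- {i}) A" for i
  have subV: "subspace (V i)" for i
    unfolding V_def by (rule subspace_row_span)
  have "\<exists>v z. v \<in> V i \<and> (\<forall>w\<in>V i. orthogonal z w) \<and> A $ i = v + z" for i
    using orthogonal_subspace_decomp_exists[of "V i" "A $ i"] span_eq_iff[THEN iffD2, OF subV] by metis
  then obtain v z where v: "\<And>i. v i \<in> V i"
    and z: "\<And>i w. w \<in> V i \<Longrightarrow> orthogonal (z i) w" and vz: "\<And>i. A $ i = v i + z i"
    by metis
  have z_nz: "z i \<noteq> 0" for i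
    using indep[of i] v[of i] vz[of i] by (auto simp: V_def)
  have dist: "infdist (A $ i) (V i) = norm (z i)" for i
    unfolding vz using subV v z by (intro infdist_subspace) (auto simp: orthogonal_commute)
  \<comment> \<open>\<open>V i\<close> is closed under left quaternion multiples, which upgrades
    real orthogonality to quaternionic orthogonality.\<close>
  have herm_V: "herm u (z i) = 0" if "u \<in> V i" for u i
  proof (rule herm_eq_0I)
    fix q
    show "orthogonal (q *s u) (z i)"
      using z[of "q *s u" i] row_span_scale[of u "- {i}" A q] that
      by (simp add: V_def orthogonal_commute)
  qed
  have "\<exists>c. v i = row_comb c A" for i
    using v[of i] by (auto simp: V_def row_span_def)
  then obtain c where c: "\<And>i. v i = row_comb (c i) A"
    by metis
  \<comment> \<open>Since \<open>z i\<close> is \<open>A $ i - v i\<close>, it is the row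
    combination with coefficients \<open>axis i 1 - c i\<close>. Thus the vectors \<open>z i\<close>
    divided by their squared norms are the rows of \<open>C ** A\<close>, the form that
    \<open>is_pseudoinverse_right_inverse\<close> asks for.\<close>
  define C :: "quat^'m^'m" where "C = (\<chi> i. (1 / (norm (z i))\<^sup>2) *\<^sub>R (axis i 1 - c i))"
  have CA: "(C ** A) $ i = (1 / (norm (z i))\<^sup>2) *\<^sub>R z i" for i
  proof -
    have "(C ** A) $ i = row_comb ((1 / (norm (z i))\<^sup>2) *\<^sub>R (axis i 1 - c i)) A"
      by (simp add: matrix_mult_row_comb C_def)
    also have "\<dots> = (1 / (norm (z i))\<^sup>2) *\<^sub>R (A $ i - v i)"
      unfolding linear_cmul[OF linear_row_comb] row_comb_diff row_comb_axis c by simp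
    finally show ?thesis
      by (simp add: vz)
  qed
  \<comment> \<open>Biorthogonality: for \<open>j \<noteq> i\<close> the row \<open>A $ j\<close>
    lies in \<open>V i\<close>; for \<open>j = i\<close> only the component \<open>z i\<close>
    contributes.\<close>
  have "(A ** conj_transpose (C ** A)) $ j $ i = mat 1 $ j $ i" for i j
  proof -
    have "(A ** conj_transpose (C ** A)) $ j $ i = herm (A $ j) ((C ** A) $ i)"
      by (simp add: matrix_matrix_mult_def[of A] conj_transpose_def herm_def)
    also have "\<dots> = (1 / (norm (z i))\<^sup>2) *\<^sub>R herm (A $ j) (z i)"
      by (simp add: CA herm_scaleR_right)
    also have "\<dots> = mat 1 $ j $ i"
    proof (cases "j = i")
      case True
      then show ?thesis
        using z_nz[of i] herm_V[OF v, of i]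
        by (simp add: vz herm_add_left herm_self mat_def of_real_def)
    next
      case False
      then show ?thesis
        using herm_V[of "A $ j" i] row_in_row_span[of j "- {i}" A] by (simp add: V_def mat_def)
    qed
    finally show ?thesis .
  qed
  then have "A ** conj_transpose (C ** A) = mat 1"
    by (simp add: vec_eq_iff)
  then have "pseudoinverse A = conj_transpose (C ** A)"
    by (intro pseudoinverse_eqI is_pseudoinverse_right_inverse)
  moreover have "(norm ((C ** A) $ i))\<^sup>2 = 1 / (norm (z i))\<^sup>2" for i
    using z_nz[of i] by (simp add: CA power2_eq_square)
  ultimately show ?thesis
    by (simp add: frobenius_norm_eq_norm norm_conj_transpose dist[unfolded V_def])
qed

section \<open>Measurability of the pseudoinverse norm and of the row distances\<close>

lemma continuous_on_conj_transpose [continuous_intros]: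
  "continuous_on S f \<Longrightarrow> continuous_on S (\<lambda>x. conj_transpose (f x))"
  unfolding conj_transpose_def by (intro continuous_intros)

lemma continuous_on_quat_matrix_mult [continuous_intros]:
  fixes f :: "_ \<Rightarrow> quat^'k^'m" and g :: "_ \<Rightarrow> quat^'n^'k"
  shows "continuous_on S f \<Longrightarrow> continuous_on S g \<Longrightarrow> continuous_on S (\<lambda>x. f x ** g x)"
  unfolding matrix_matrix_mult_def by (intro continuous_intros)

lemma closed_is_pseudoinverse:
  "closed {(X :: quat^'m^'n, A :: quat^'n^'m). is_pseudoinverse A X}"
  unfolding is_pseudoinverse_def case_prod_beta Collect_conj_eq
  by (intro closed_Int closed_Collect_eq continuous_intros)

text \<open>Bounded parts of the graph of the pseudoinverse are closed, and projecting them along a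
  compact ball gives closed sets; on the (a priori possible) matrices without a pseudoinverse
  the definite description is one fixed junk value.\<close>

lemma borel_measurable_norm_pseudoinverse [measurable]:
  "(\<lambda>A :: quat^'n^'m. frobenius_norm (pseudoinverse A)) \<in> borel_measurable borel"
proof -
  let ?E = "\<lambda>c. {A :: quat^'n^'m. \<exists>X. X \<in> cball 0 c \<and> (X, A) \<in> {(X, A). is_pseudoinverse A X}}"
  define junk :: "quat^'m^'n" where "junk = (THE X. False)"
  have junk: "pseudoinverse A = junk" if "\<not> (\<exists>X. is_pseudoinverse A X)" for A :: "quat^'n^'m"
    using that by (simp add: pseudoinverse_def junk_def)
  have closed_E: "closed (?E c)" for c
    by (intro closed_compact_projection closed_is_pseudoinverse compact_cball)
  have ex: "(\<exists>X. is_pseudoinverse A X) \<longleftrightarrow> A \<in> (\<Union>n. ?E (real n))" for A :: "quat^'n^'m"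
  proof
    assume "\<exists>X. is_pseudoinverse A X"
    then obtain X where "is_pseudoinverse A X" by blast
    moreover obtain n where "norm X \<le> real n"
      using real_arch_simple by blast
    ultimately show "A \<in> (\<Union>n. ?E (real n))" by auto
  qed auto
  have "{A :: quat^'n^'m. frobenius_norm (pseudoinverse A) \<le> c}
      = ?E c \<union> (if norm junk \<le> c then - (\<Union>n. ?E (real n)) else {})" for c
  proof (rule set_eqI)
    fix A :: "quat^'n^'m"
    show "A \<in> {A. frobenius_norm (pseudoinverse A) \<le> c}
      \<longleftrightarrow> A \<in> ?E c \<union> (if norm junk \<le> c then - (\<Union>n. ?E (real n)) else {})"
    proof (cases "\<exists>X. is_pseudoinverse A X")
      case True
      then obtain X where X: "is_pseudoinverse A X" by blast
      then have "is_pseudoinverse A Y \<longleftrightarrow> Y = X" for Y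
        using is_pseudoinverse_unique by blast
      then have "A \<in> ?E c \<longleftrightarrow> norm X \<le> c" by simp
      moreover have "A \<in> (\<Union>n. ?E (real n))"
        using True ex by blast
      ultimately show ?thesis
        using pseudoinverse_eqI[OF X] by (auto simp: frobenius_norm_eq_norm)
    next
      case False
      then have "A \<notin> ?E c" "A \<notin> (\<Union>n. ?E (real n))"
        by blast+
      then show ?thesis
        unfolding Un_iff mem_Collect_eq junk[OF False] frobenius_norm_eq_norm by simp
    qed
  qed
  moreover have "?E c \<in> sets borel" for c
    using closed_E by (rule borel_closed)
  ultimately show ?thesis
    by (intro borel_measurableI_le) (simp del: mem_cball)
qed

text \<open>The dimension of the row span may jump with \<open>A\<close>, but the distance is upper
  semicontinuous: it is below \<open>r\<close> iff some fixed coefficient vector \<open>c\<close>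
  gives a combination closer than \<open>r\<close>, and for each \<open>c\<close> this is an open
  condition on \<open>A\<close>.\<close>

lemma borel_measurable_infdist_row_span [measurable]:
  "(\<lambda>A :: quat^'n^'m. infdist (A $ i) (row_span S A)) \<in> borel_measurable borel"
proof -
  have "open {A :: quat^'n^'m. infdist (A $ i) (row_span S A) < r}" for r
  proof -
    have "infdist (A $ i) (row_span S A) < r \<longleftrightarrow>
        (\<exists>c. (\<forall>j. j \<notin> S \<longrightarrow> c $ j = 0) \<and> dist (A $ i) (row_comb c A) < r)" for A :: "quat^'n^'m"
    proof -
      have ne: "row_span S A \<noteq> {}"
        using subspace_0[OF subspace_row_span] by blast
      have "bdd_below (dist (A $ i) ` row_span S A)"
        by (rule bdd_belowI2[of _ 0]) simp
      from cINF_less_iff[OF ne this] ne show ?thesis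
        by (auto simp: infdist_notempty row_span_def)
    qed
    then have "{A :: quat^'n^'m. infdist (A $ i) (row_span S A) < r} =
        (\<Union>c\<in>{c. \<forall>j. j \<notin> S \<longrightarrow> c $ j = 0}. {A. dist (A $ i) (row_comb c A) < r})"
      by auto
    also have "open \<dots>"
      by (intro open_UN ballI open_Collect_less continuous_intros)
    finally show ?thesis .
  qed
  then show ?thesis
    by (intro borel_measurableI_less) auto
qed

section \<open>Gaussian quaternion matrices\<close>

lemma row_span_cong:
  assumes "\<And>j. j \<in> S \<Longrightarrow> A $ j = B $ j"
  shows "row_span S A = row_span S B"
proof -
  have "row_comb c A = row_comb c B" if "\<forall>j. j \<notin> S \<longrightarrow> c $ j = 0" for c
  proof -
    have "c $ j * A $ j $ k = c $ j * B $ j $ k" for j k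
      using assms[of j] that by (cases "j \<in> S") simp_all
    then show ?thesis
      by (simp only: row_comb_def)
  qed
  then show ?thesis
    unfolding row_span_def by (intro image_cong) simp_all
qed

text \<open>One family indexed by (component, row, column) lets the law be a single product measure,
  which the index sets \<open>row_coords\<close> split by rows.\<close>

definition quat_mat :: "(nat \<times> 'm \<times> 'n \<Rightarrow> real) \<Rightarrow> quat^'n^'m"
  where "quat_mat x = (\<chi> i j. Quat (x (0, i, j)) (x (1, i, j)) (x (2, i, j)) (x (3, i, j)))"

abbreviation (input) row_coords :: "'m set \<Rightarrow> (nat \<times> 'm \<times> 'n) set"
  where "row_coords S \<equiv> {..<4} \<times> S \<times> UNIV"

lemma borel_measurable_quat_mat [measurable]:
  "(quat_mat :: (nat \<times> 'm::finite \<times> 'n::finite \<Rightarrow> real) \<Rightarrow> _)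
    \<in> borel_measurable (PiM (row_coords UNIV) (\<lambda>_. borel))"
proof -
  have "(\<lambda>x. quat_mat x \<bullet> b) \<in> borel_measurable
      (PiM (row_coords UNIV :: (nat \<times> 'm \<times> 'n) set) (\<lambda>_. borel))" if b: "b \<in> Basis" for b :: "quat^'n^'m"
  proof -
    obtain i j q where "b = axis i (axis j q)"
      using b unfolding Basis_vec_def by blast
    then show ?thesis
      by (simp add: inner_axis quat_mat_def inner_quat_def)
  qed
  then show ?thesis
    by (subst borel_measurable_euclidean_space) (rule ballI)
qed

lemma borel_measurable_quat_mat_std_gaussian [measurable]:
  "(quat_mat :: (nat \<times> 'm::finite \<times> 'n::finite \<Rightarrow> real) \<Rightarrow> _)
    \<in> borel_measurable (std_gaussian (row_coords UNIV))"
proof -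
  have "sets (std_gaussian (row_coords UNIV :: (nat \<times> 'm \<times> 'n) set))
      = sets (PiM (row_coords UNIV) (\<lambda>_. borel :: real measure))"
    by (intro sets_PiM_cong) simp_all
  from measurable_cong_sets[OF this refl] show ?thesis
    using borel_measurable_quat_mat by blast
qed

text \<open>The row index is ignored: the coordinates of every row are matched with the same real
  basis of \<open>quat^'n\<close>.\<close>

definition row_basis :: "nat \<times> 'm \<times> 'n \<Rightarrow> quat^'n"
  where "row_basis = (\<lambda>(k, i, j). axis j ([1, quat_i, quat_j, quat_k] ! k))"

lemma bij_betw_row_basis: "bij_betw (row_basis :: nat \<times> 'm \<times> 'n::finite \<Rightarrow> quat^'n) (row_coords {i}) Basis"
proof -
  let ?u = "[1, quat_i, quat_j, quat_k]"
  have "distinct ?u"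
    by (simp add: quat_i_def quat_j_def quat_k_def quat_eq_iff)
  then have "bij_betw ((!) ?u) {..<4} Basis"
    by (intro bij_betw_nth) (auto simp: Basis_quat_def)
  then have inj: "inj_on ((!) ?u) {..<4}" and img: "(!) ?u ` {..<4} = Basis"
    by (auto simp: bij_betw_def)
  have "?u ! k \<noteq> 0" if "k < 4" for k
    using img that nonzero_Basis by blast
  then have "inj_on (row_basis :: nat \<times> 'm \<times> 'n \<Rightarrow> quat^'n) (row_coords {i})"
    using inj by (fastforce simp: inj_on_def row_basis_def axis_eq_axis)
  moreover have "(row_basis :: nat \<times> 'm \<times> 'n \<Rightarrow> quat^'n) ` row_coords {i} = Basis"
    unfolding Basis_vec_def img[symmetric] by (force simp: row_basis_def)
  ultimately show ?thesis
    by (simp add: bij_betw_def)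
qed

lemma row_quat_mat:
  fixes x :: "nat \<times> 'm::finite \<times> 'n::finite \<Rightarrow> real"
  shows "quat_mat x $ i = (\<Sum>s\<in>row_coords {i}. x s *\<^sub>R row_basis s)"
proof -
  have "(\<Sum>s\<in>row_coords {i}. x s *\<^sub>R row_basis s) $ j = quat_mat x $ i $ j" for j
  proof -
    have "(\<Sum>s\<in>row_coords {i}. x s *\<^sub>R row_basis s) $ j
        = (\<Sum>k<4. \<Sum>l\<in>UNIV. x (k, i, l) *\<^sub>R axis l ([1, quat_i, quat_j, quat_k] ! k) $ j)"
      by (simp add: sum.cartesian_product' row_basis_def)
    also have "\<dots> = (\<Sum>k<4. x (k, i, j) *\<^sub>R [1, quat_i, quat_j, quat_k] ! k)"
      by (simp add: axis_def if_distrib[where f = "\<lambda>q. _ *\<^sub>R q"] cong: if_cong)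
    also have "\<dots> = quat_mat x $ i $ j"
      by (simp add: eval_nat_numeral quat_mat_def quat_eq_iff quat_i_def quat_j_def quat_k_def)
    finally show ?thesis .
  qed
  then show ?thesis
    by (simp add: vec_eq_iff)
qed

text \<open>Row \<open>i\<close> is integrated first, with the other rows and hence their span
  fixed. The dimension stays random here, because the almost sure independence of the rows is itself
  derived from this formula.\<close>

lemma nn_integral_inverse_infdist_row:
  fixes i :: "'m::finite"
  defines "\<gamma> \<equiv> std_gaussian (row_coords UNIV :: (nat \<times> 'm \<times> 'n::finite) set)"
  assumes mn: "CARD('m) \<le> CARD('n)"
  defines "d \<equiv> \<lambda>A :: quat^'n^'m. dim (row_span (- {i}) A)"
  shows "(\<integral>\<^sup>+x. inverse (ennreal ((infdist (quat_mat x $ i) (row_span (- {i}) (quat_mat x)))\<^sup>2)) \<partial>\<gamma>)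
    = (\<integral>\<^sup>+x. ennreal (1 / (4 * real CARD('n) - real (d (quat_mat x)) - 2)) \<partial>\<gamma>)"
proof -
  interpret product_prob_space "\<lambda>_ :: nat \<times> 'm \<times> 'n. std_normal_distribution"
    by standard
  let ?I = "row_coords UNIV :: (nat \<times> 'm \<times> 'n) set"
  let ?J = "row_coords {i} :: (nat \<times> 'm \<times> 'n) set"
  let ?K = "row_coords (- {i}) :: (nat \<times> 'm \<times> 'n) set"
  have KJ: "?K \<union> ?J = ?I" "?K \<inter> ?J = {}"
    by auto
  define F where "F A = inverse (ennreal ((infdist (A $ i) (row_span (- {i}) A))\<^sup>2))" for A :: "quat^'n^'m"
  have [measurable]: "F \<in> borel_measurable borel"
    unfolding F_def by measurable
  have F_meas: "(\<lambda>x. F (quat_mat x)) \<in> borel_measurable (std_gaussian (?K \<union> ?J))"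
    unfolding KJ by measurable
  have row_span_merge: "row_span (- {i}) (quat_mat (merge ?K ?J (x, y))) = row_span (- {i}) (quat_mat x)" for x y
    by (intro row_span_cong) (auto simp: quat_mat_def vec_eq_iff merge_def)
  have row_span_restrict: "row_span (- {i}) (quat_mat (restrict x ?K)) = row_span (- {i}) (quat_mat x)" for x
    by (intro row_span_cong) (auto simp: quat_mat_def vec_eq_iff)
  have row_merge: "quat_mat (merge ?K ?J (x, y)) $ i = (\<Sum>s\<in>?J. y s *\<^sub>R row_basis s)" for x y
    unfolding row_quat_mat by (intro sum.cong) (auto simp: merge_def)
  have inner: "(\<integral>\<^sup>+y. F (quat_mat (merge ?K ?J (x, y))) \<partial>std_gaussian ?J)
      = ennreal (1 / (4 * real CARD('n) - real (d (quat_mat x)) - 2))" for x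
  proof -
    \<comment> \<open>The other rows span at most \<open>4 * (CARD('m) - 1)\<close> real dimensions,
      so at least four degrees of freedom remain.\<close>
    have "card (- {i}) = CARD('m) - 1"
      by (simp add: Compl_eq_Diff_UNIV card_Diff_subset)
    then have "d (quat_mat x) \<le> 4 * (CARD('m) - 1)"
      using dim_row_span_le[of "- {i}" "quat_mat x"] by (simp add: d_def)
    moreover have "CARD('m) > 0"
      by simp
    ultimately have "d (quat_mat x) + 3 \<le> CARD('n) * 4"
      using mn by linarith
    then have "d (quat_mat x) + 3 \<le> DIM(quat^'n)"
      by simp
    from nn_integral_inverse_infdist_subspace_std_gaussian[OF subspace_row_span bij_betw_row_basis this[unfolded d_def]]
    show ?thesis
      by (simp add: F_def row_span_merge row_merge d_def mult.commute)
  qed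
  \<comment> \<open>Through \<open>inner\<close> this also gives measurability of the term
    containing the dimension, used below to pass from \<open>?K\<close> back to all
    coordinates.\<close>
  have inner_meas: "(\<lambda>x. \<integral>\<^sup>+y. F (quat_mat (merge ?K ?J (x, y))) \<partial>std_gaussian ?J)
      \<in> borel_measurable (std_gaussian ?K)"
  proof -
    interpret J: prob_space "std_gaussian ?J" by (rule prob_space_std_gaussian)
    have "(\<lambda>p. F (quat_mat (merge ?K ?J p))) \<in> borel_measurable (std_gaussian ?K \<Otimes>\<^sub>M std_gaussian ?J)"
      using measurable_comp[OF measurable_merge F_meas] by (simp add: comp_def)
    then show ?thesis
      by (intro J.borel_measurable_nn_integral) (simp add: case_prod_beta')
  qed
  have "(\<integral>\<^sup>+x. F (quat_mat x) \<partial>\<gamma>)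
      = (\<integral>\<^sup>+x. \<integral>\<^sup>+y. F (quat_mat (merge ?K ?J (x, y))) \<partial>std_gaussian ?J \<partial>std_gaussian ?K)"
    unfolding \<gamma>_def KJ(1)[symmetric] using KJ(2) F_meas
    by (intro product_nn_integral_fold) auto
  also have "\<dots> = (\<integral>\<^sup>+x. ennreal (1 / (4 * real CARD('n) - real (d (quat_mat x)) - 2)) \<partial>std_gaussian ?K)"
    by (simp only: inner)
  also have "\<dots> = (\<integral>\<^sup>+x. ennreal (1 / (4 * real CARD('n) - real (d (quat_mat x)) - 2)) \<partial>\<gamma>)"
  proof -
    have "std_gaussian ?K = distr \<gamma> (std_gaussian ?K) (\<lambda>x. restrict x ?K)"
      unfolding \<gamma>_def by (rule distr_restrict) auto
    then have "(\<integral>\<^sup>+x. ennreal (1 / (4 * real CARD('n) - real (d (quat_mat x)) - 2)) \<partial>std_gaussian ?K)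
        = (\<integral>\<^sup>+x. ennreal (1 / (4 * real CARD('n) - real (d (quat_mat x)) - 2))
            \<partial>distr \<gamma> (std_gaussian ?K) (\<lambda>x. restrict x ?K))"
      by simp
    also have "\<dots> = (\<integral>\<^sup>+x. ennreal (1 / (4 * real CARD('n) - real (d (quat_mat (restrict x ?K))) - 2)) \<partial>\<gamma>)"
      using inner_meas unfolding inner \<gamma>_def
      by (intro nn_integral_distr measurable_restrict_subset) auto
    finally show ?thesis
      by (simp add: d_def row_span_restrict)
  qed
  finally show ?thesis
    by (simp add: F_def)
qed

lemma AE_rows_independent:
  assumes mn: "CARD('m) \<le> CARD('n)"
  shows "AE x in std_gaussian (row_coords UNIV).
    \<forall>i. (quat_mat x :: quat^'n::finite^'m::finite) $ i \<notin> row_span (- {i}) (quat_mat x)"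
proof -
  let ?\<gamma> = "std_gaussian (row_coords UNIV :: (nat \<times> 'm \<times> 'n) set)"
  interpret prob_space ?\<gamma> by (rule prob_space_std_gaussian)
  let ?D = "\<lambda>x i. infdist ((quat_mat x :: quat^'n^'m) $ i) (row_span (- {i}) (quat_mat x))"
  have "AE x in ?\<gamma>. (quat_mat x :: quat^'n^'m) $ i \<notin> row_span (- {i}) (quat_mat x)" for i
  proof -
    have "(\<integral>\<^sup>+x. inverse (ennreal ((?D x i)\<^sup>2)) \<partial>?\<gamma>)
      \<le> (\<integral>\<^sup>+x. 1 \<partial>?\<gamma>)"
      unfolding nn_integral_inverse_infdist_row[OF mn]
    proof (intro nn_integral_mono)
      fix x
      have "dim (row_span (- {i}) (quat_mat x :: quat^'n^'m)) \<le> 4 * (CARD('m) - 1)"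
        using dim_row_span_le[of "- {i}" "quat_mat x"] by (simp add: Compl_eq_Diff_UNIV card_Diff_subset)
      moreover have "CARD('m) > 0"
        by simp
      ultimately have "real (dim (row_span (- {i}) (quat_mat x :: quat^'n^'m))) + 3 \<le> 4 * real CARD('n)"
        using mn by linarith
      then show "ennreal (1 / (4 * real CARD('n)
          - real (dim (row_span (- {i}) (quat_mat x :: quat^'n^'m))) - 2)) \<le> 1"
        by (simp add: divide_le_eq_1)
    qed
    \<comment> \<open>A row inside the span has distance 0, where the integrand is infinite; a
      finite integral makes this a null event.\<close>
    then have "(\<integral>\<^sup>+x. inverse (ennreal ((?D x i)\<^sup>2)) \<partial>?\<gamma>) \<noteq> \<infinity>"
      unfolding nn_integral_const emeasure_space_1 by (auto simp: top_unique)
    then have "AE x in ?\<gamma>. inverse (ennreal ((?D x i)\<^sup>2)) \<noteq> \<infinity>"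
      by (rule nn_integral_PInf_AE[rotated]) measurable
    then show ?thesis
      by (rule AE_mp) (auto intro!: AE_I2)
  qed
  then show ?thesis
    by (intro AE_finite_all[THEN iffD2, of UNIV, simplified]) auto
qed

lemma nn_integral_norm_pseudoinverse_std_gaussian:
  assumes mn: "CARD('m) \<le> CARD('n)"
  shows "(\<integral>\<^sup>+x. ennreal ((frobenius_norm (pseudoinverse (quat_mat x :: quat^'n::finite^'m::finite)))\<^sup>2)
      \<partial>std_gaussian (row_coords UNIV))
    = ennreal (real CARD('m) / (4 * (real CARD('n) - real CARD('m)) + 2))"
proof -
  let ?\<gamma> = "std_gaussian (row_coords UNIV :: (nat \<times> 'm \<times> 'n) set)"
  let ?c = "1 / (4 * (real CARD('n) - real CARD('m)) + 2)"
  interpret prob_space ?\<gamma> by (rule prob_space_std_gaussian)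
  define D where "D i x = infdist ((quat_mat x :: quat^'n^'m) $ i) (row_span (- {i}) (quat_mat x))" for i x
  have [measurable]: "D i \<in> borel_measurable ?\<gamma>" for i
    unfolding D_def by measurable
  have D_int: "(\<integral>\<^sup>+x. inverse (ennreal ((D i x)\<^sup>2)) \<partial>?\<gamma>) = ennreal ?c" for i
  proof -
    have "(\<integral>\<^sup>+x. inverse (ennreal ((D i x)\<^sup>2)) \<partial>?\<gamma>) = (\<integral>\<^sup>+x. ennreal ?c \<partial>?\<gamma>)"
      unfolding D_def nn_integral_inverse_infdist_row[OF mn]
    proof (rule nn_integral_cong_AE, rule AE_mp[OF AE_rows_independent[OF mn]], intro AE_I2 impI)
      fix x
      assume "\<forall>i. (quat_mat x :: quat^'n^'m) $ i \<notin> row_span (- {i}) (quat_mat x)"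
      \<comment> \<open>With the exact dimension the denominator is
        \<open>4 n - 4 (m - 1) - 2 = 4 (n - m) + 2\<close>.\<close>
      then have "dim (row_span (- {i}) (quat_mat x :: quat^'n^'m)) = 4 * (CARD('m) - 1)"
        using dim_row_span[of "quat_mat x" "- {i}"] by (simp add: Compl_eq_Diff_UNIV card_Diff_subset)
      moreover have "real (CARD('m) - 1) = real CARD('m) - 1"
        by (simp add: of_nat_diff)
      ultimately show "ennreal (1 / (4 * real CARD('n)
          - real (dim (row_span (- {i}) (quat_mat x :: quat^'n^'m))) - 2)) = ennreal ?c"
        by (simp add: algebra_simps)
    qed
    then show ?thesis
      unfolding nn_integral_const emeasure_space_1 by simp
  qed
  have "(\<integral>\<^sup>+x. ennreal ((frobenius_norm (pseudoinverse (quat_mat x :: quat^'n^'m)))\<^sup>2) \<partial>?\<gamma>)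
      = (\<integral>\<^sup>+x. (\<Sum>i\<in>UNIV. inverse (ennreal ((D i x)\<^sup>2))) \<partial>?\<gamma>)"
  proof (rule nn_integral_cong_AE, rule AE_mp[OF AE_rows_independent[OF mn]], intro AE_I2 impI)
    fix x
    assume indep: "\<forall>i. (quat_mat x :: quat^'n^'m) $ i \<notin> row_span (- {i}) (quat_mat x)"
    \<comment> \<open>Finite-dimensional subspaces are closed, so a point outside has positive
      distance.\<close>
    have D_pos: "0 < D i x" for i
      unfolding D_def using indep subspace_row_span[of "- {i}" "quat_mat x"]
      by (intro infdist_pos_not_in_closed closed_subspace) (auto dest: subspace_0)
    have "inverse (ennreal ((D i x)\<^sup>2)) = ennreal (1 / (D i x)\<^sup>2)" for i
      using D_pos[of i] by (simp add: inverse_ennreal inverse_eq_divide)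
    then show "ennreal ((frobenius_norm (pseudoinverse (quat_mat x :: quat^'n^'m)))\<^sup>2)
        = (\<Sum>i\<in>UNIV. inverse (ennreal ((D i x)\<^sup>2)))"
      using indep by (simp add: norm_pseudoinverse_rows D_def)
  qed
  also have "\<dots> = (\<Sum>i\<in>(UNIV :: 'm set). ennreal ?c)"
    by (subst nn_integral_sum) (measurable, simp only: D_int)
  also have "\<dots> = ennreal (real CARD('m) * ?c)"
    using mn by (simp add: ennreal_of_nat_eq_real_of_nat ennreal_mult[symmetric])
  finally show ?thesis by simp
qed

theorem theorem5:
  fixes M :: "'w measure"
    and G0 G1 G2 G3 :: "'w \<Rightarrow> real^'n^'m"
    and G :: "'w \<Rightarrow> quat^'n^'m"
  assumes "prob_space M"
    and "CARD('m) \<le> CARD('n)"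
    and "\<And>k i j. k < 4 \<Longrightarrow>
      distributed M lborel (\<lambda>\<omega>. ([G0, G1, G2, G3] ! k) \<omega> $ i $ j) std_normal_density"
    and "prob_space.indep_vars M (\<lambda>_. borel)
      (\<lambda>(k, i, j) \<omega>. ([G0, G1, G2, G3] ! k) \<omega> $ i $ j) ({..<4} \<times> UNIV \<times> UNIV)"
    and "\<And>\<omega> i j. \<omega> \<in> space M \<Longrightarrow> G \<omega> $ i $ j =
      of_real (G0 \<omega> $ i $ j) + of_real (G1 \<omega> $ i $ j) * quat_i
      + of_real (G2 \<omega> $ i $ j) * quat_j + of_real (G3 \<omega> $ i $ j) * quat_k"
  shows "prob_space.expectation M (\<lambda>\<omega>. (frobenius_norm (pseudoinverse (G \<omega>)))\<^sup>2)
    = real CARD('m) / (4 * (real CARD('n) - real CARD('m)) + 2)"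
proof -
  interpret prob_space M by fact
  let ?I = "row_coords UNIV :: (nat \<times> 'm \<times> 'n) set"
  define X where "X = (\<lambda>(k, i, j) \<omega>. ([G0, G1, G2, G3] ! k) \<omega> $ i $ j)"
  define Y where "Y \<omega> = (\<lambda>s\<in>?I. X s \<omega>)" for \<omega>
  define f where "f A = (frobenius_norm (pseudoinverse A))\<^sup>2" for A :: "quat^'n^'m"
  have [measurable]: "f \<in> borel_measurable borel"
    unfolding f_def by measurable
  have X_distr: "distr M borel (X s) = std_normal_distribution"
    and X_meas: "X s \<in> borel_measurable M" if s_in: "s \<in> ?I" for s
  proof -
    obtain k i j where s: "s = (k, i, j)" "k < 4"
      using s_in by auto
    have "distributed M lborel (X s) std_normal_density"
      using assms(3)[OF s(2)] by (simp add: X_def s)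
    then have *: "distr M lborel (X s) = std_normal_distribution" "X s \<in> measurable M lborel"
      by (auto simp: distributed_def)
    show "X s \<in> borel_measurable M"
      using *(2) by simp
    show "distr M borel (X s) = std_normal_distribution"
      using *(1) by (simp cong: distr_cong)
  qed
  have Y_meas [measurable]: "Y \<in> measurable M (PiM ?I (\<lambda>_. borel))"
    unfolding Y_def using X_meas by (intro measurable_restrict)
  have "indep_vars (\<lambda>_. borel) X ?I"
    using assms(4) by (simp add: X_def)
  \<comment> \<open>Independence makes the joint law of the coordinates the product of their
    marginals.\<close>
  then have "distr M (PiM ?I (\<lambda>_. borel)) Y = PiM ?I (\<lambda>s. distr M borel (X s))"
    unfolding Y_def using X_meas by (subst (asm) indep_vars_iff_distr_eq_PiM') (auto simp: lessThan_empty_iff)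
  also have "\<dots> = std_gaussian ?I"
    using X_distr by (intro PiM_cong) auto
  finally have Y_distr: "distr M (PiM ?I (\<lambda>_. borel)) Y = std_gaussian ?I" .
  have G: "G \<omega> = quat_mat (Y \<omega>)" if "\<omega> \<in> space M" for \<omega>
    using assms(5)[OF that]
    by (simp add: vec_eq_iff quat_mat_def Quat_eq Y_def X_def eval_nat_numeral)
  have "expectation (\<lambda>\<omega>. f (G \<omega>)) = expectation (\<lambda>\<omega>. f (quat_mat (Y \<omega>)))"
    by (intro Bochner_Integration.integral_cong) (simp_all add: G)
  \<comment> \<open>The nonnegative integral turns out finite, so the expectation is a genuine value
    and not the default 0 of a non-integrable function.\<close>
  also have "\<dots> = enn2real (\<integral>\<^sup>+\<omega>. ennreal (f (quat_mat (Y \<omega>))) \<partial>M)"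
    by (intro integral_eq_nn_integral) (simp_all add: f_def)
  also have "(\<integral>\<^sup>+\<omega>. ennreal (f (quat_mat (Y \<omega>))) \<partial>M) = (\<integral>\<^sup>+x. ennreal (f (quat_mat x)) \<partial>std_gaussian ?I)"
    unfolding Y_distr[symmetric] by (subst nn_integral_distr) measurable
  also have "\<dots> = ennreal (real CARD('m) / (4 * (real CARD('n) - real CARD('m)) + 2))"
    unfolding f_def by (rule nn_integral_norm_pseudoinverse_std_gaussian[OF assms(2)])
  finally show ?thesis
    using assms(2) by (simp add: f_def)
qed

end
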